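(* For all nonnegative integers $m$ and $n$, $$2^{n}\sum_{k=0}^{n}\binom{k+m}{k}\frac{1}{2^{k}}=\sum_{k=0}^{n}\binom{m+1+n}{m+1+k}.$$ *)

theory Defs
  imports Complex_Main
begin

end

theory Submission
  imports Defs
begin

text \<open>Both sides equal 1 at \<open>n = 0\<close> and satisfy the same recurrence: the value at
  \<open>Suc n\<close> is twice the value at \<open>n\<close> plus
  \<open>(Suc n + m) choose Suc n\<close>. On the left this is immediate from the factor
  \<open>2 ^ n\<close>; on the right it is \<open>sum_upper_choose_Suc\<close>.\<close>

text \<open>Pascal's rule splits the sum into two near-copies of the sum for \<open>n\<close>; they
  differ from it only in boundary terms, one of which survives.\<close>

lemma sum_upper_choose_Suc:
  fixes m n :: nat
  shows "(\<Sum>k=0..Suc n. (m + 1 + Suc n) choose (m + 1 + k))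
       = 2 * (\<Sum>k=0..n. (m + 1 + n) choose (m + 1 + k)) + ((Suc n + m) choose Suc n)"
proof -
  have "(\<Sum>k=0..Suc n. (m + 1 + Suc n) choose (m + 1 + k))
      = (\<Sum>k=0..Suc n. (m + 1 + n) choose (m + k)) + (\<Sum>k=0..Suc n. (m + 1 + n) choose (m + 1 + k))"
    by (simp add: sum.distrib)
  also have "(\<Sum>k=0..Suc n. (m + 1 + n) choose (m + k))
      = ((m + 1 + n) choose m) + (\<Sum>k=0..n. (m + 1 + n) choose (m + 1 + k))"
    unfolding sum.atLeast0_atMost_Suc_shift by simp
  also have "(m + 1 + n) choose m = (Suc n + m) choose Suc n"
    using binomial_symmetric[of m "m + 1 + n"] by (simp add: add_ac)
  \<comment> \<open>The term at \<open>k = Suc n\<close> vanishes, its lower index exceeding the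
    upper one by 1.\<close>
  also have "(\<Sum>k=0..Suc n. (m + 1 + n) choose (m + 1 + k))
      = (\<Sum>k=0..n. (m + 1 + n) choose (m + 1 + k))"
    by simp
  finally show ?thesis
    by simp
qed

theorem lemma12:
  fixes m n :: nat
  shows "(2::real) ^ n * (\<Sum>k=0..n. real ((k + m) choose k) * (1 / 2 ^ k))
       = (\<Sum>k=0..n. real ((m + 1 + n) choose (m + 1 + k)))"
proof (induction n)
  case 0
  then show ?case by simp
next
  case (Suc n)
  \<comment> \<open>In the new summand \<open>k = Suc n\<close> the weight cancels against
    \<open>2 ^ Suc n\<close>. Its binomial must stay whole, so Pascal's rule is kept out of the
    simplification.\<close>
  have "(2::real) ^ Suc n * (\<Sum>k=0..Suc n. real ((k + m) choose k) * (1 / 2 ^ k))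
      = 2 * (2 ^ n * (\<Sum>k=0..n. real ((k + m) choose k) * (1 / 2 ^ k))) + real ((Suc n + m) choose Suc n)"
    by (simp add: distrib_left del: binomial_Suc_Suc)
  also have "\<dots> = real (2 * (\<Sum>k=0..n. (m + 1 + n) choose (m + 1 + k)) + ((Suc n + m) choose Suc n))"
    unfolding Suc.IH by simp
  also have "\<dots> = (\<Sum>k=0..Suc n. real ((m + 1 + Suc n) choose (m + 1 + k)))"
    unfolding sum_upper_choose_Suc[symmetric] by (rule of_nat_sum)
  finally show ?case .
qed

end
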